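(* Let $\lambda_{\mathrm{SSS}}$ be the greatest real number such that, for every $\epsilon>0$, there are only finitely many totally positive algebraic integers $\alpha$ satisfying $\operatorname{tr}(\alpha) < (\lambda_{\mathrm{SSS}}-\epsilon)\deg(\alpha)$. Then $$\lambda_{\mathrm{SSS}} < 1.89831.$$
   Context: For an algebraic integer $\alpha\in\mathbb{C}$, let $\alpha_1=\alpha,\alpha_2,\dots,\alpha_n$ be the complex roots of the minimal polynomial of $\alpha$ over $\mathbb{Q}$ (the conjugates of $\alpha$). Then $\deg(\alpha)=n$ and $\operatorname{tr}(\alpha)=\alpha_1+\dots+\alpha_n$. The algebraic integer $\alpha$ is called totally positive if all of its conjugates $\alpha_1,\dots,\alpha_n$ are positive real numbers. *)

theory Defs
  imports Complex_Main "HOL-Computational_Algebra.Computational_Algebra"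
begin

abbreviation of_rat_poly :: "rat poly \<Rightarrow> complex poly" where
  "of_rat_poly \<equiv> map_poly of_rat"

definition is_min_poly :: "complex \<Rightarrow> rat poly \<Rightarrow> bool" where
  "is_min_poly \<alpha> p \<longleftrightarrow> lead_coeff p = 1 \<and> irreducible p \<and> poly (of_rat_poly p) \<alpha> = 0"

text \<open>Meaningful for algebraic numbers only; see \<open>ex1_is_min_poly\<close> below.\<close>

definition min_poly :: "complex \<Rightarrow> rat poly" where
  "min_poly \<alpha> = (THE p. is_min_poly \<alpha> p)"

definition conjugates :: "complex \<Rightarrow> complex multiset" where
  "conjugates \<alpha> = proots (of_rat_poly (min_poly \<alpha>))"

definition alg_degree :: "complex \<Rightarrow> nat" where
  "alg_degree \<alpha> = degree (min_poly \<alpha>)"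

definition alg_trace :: "complex \<Rightarrow> complex" where
  "alg_trace \<alpha> = (\<Sum>z\<in>#conjugates \<alpha>. z)"

definition totally_positive :: "complex \<Rightarrow> bool" where
  "totally_positive \<alpha> \<longleftrightarrow> algebraic_int \<alpha> \<and> (\<forall>z\<in>#conjugates \<alpha>. z \<in> \<real> \<and> Re z > 0)"

text \<open>The trace of a totally positive \<open>\<alpha>\<close> is real, so taking its real part loses nothing.\<close>

definition SSS_bound :: "real \<Rightarrow> bool" where
  "SSS_bound \<mu> \<longleftrightarrow> (\<forall>\<epsilon>>0. finite {\<alpha>. totally_positive \<alpha> \<and>
     Re (alg_trace \<alpha>) < (\<mu> - \<epsilon>) * real (alg_degree \<alpha>)})"

text \<open>If no greatest element existed, \<open>GREATEST\<close> would return an unspecified real, so an upper bound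
  on \<open>lambda_SSS\<close> can only be proved together with the existence of the greatest element.\<close>

definition lambda_SSS :: real where
  "lambda_SSS = (GREATEST \<mu>. SSS_bound \<mu>)"

lemma of_rat_poly_add: "of_rat_poly (p + q) = of_rat_poly p + of_rat_poly q"
  by (rule poly_eqI) (simp add: coeff_map_poly of_rat_add)

lemma of_rat_poly_mult: "of_rat_poly (p * q) = of_rat_poly p * of_rat_poly q"
  by (rule poly_eqI) (simp add: coeff_map_poly coeff_mult of_rat_sum of_rat_mult)

lemma monic_degree_0:
  fixes p :: "rat poly"
  assumes "lead_coeff p = 1" "degree p = 0"
  shows "p = 1"
  using assms by (metis coeff_pCons_0 degree_eq_zeroE one_pCons)

lemma ex1_is_min_poly:
  assumes "algebraic_int \<alpha>"
  shows "\<exists>!p. is_min_poly \<alpha> p"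
proof -
  define R where "R p \<longleftrightarrow> poly (of_rat_poly p) \<alpha> = 0" for p
  obtain q0 where q0: "q0 \<noteq> 0" "R q0"
  proof -
    from assms obtain q :: "int poly"
      where q: "poly (map_poly of_int q) \<alpha> = 0" "lead_coeff q = 1"
      unfolding algebraic_int_altdef_ipoly by blast
    have eq: "of_rat_poly (map_poly of_int q) = map_poly of_int q"
      by (rule poly_eqI) (simp add: coeff_map_poly)
    have "coeff (map_poly rat_of_int q) (degree q) = 1"
      using q(2) by (simp add: coeff_map_poly)
    then have "map_poly rat_of_int q \<noteq> 0" by auto
    with q(1) eq show ?thesis using that unfolding R_def by metis
  qed
  define P where "P p \<longleftrightarrow> p \<noteq> 0 \<and> R p" for p
  define p1 where "p1 = arg_min degree P"
  have "P q0" using q0 by (simp add: P_def)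
  then have p1: "P p1" and least: "\<And>q. P q \<Longrightarrow> degree p1 \<le> degree q"
    unfolding p1_def by (auto intro: arg_min_natI arg_min_nat_le)
  define p where "p = smult (inverse (lead_coeff p1)) p1"
  have p1nz: "p1 \<noteq> 0" using p1 by (simp add: P_def)
  have monic: "lead_coeff p = 1" using p1nz by (simp add: p_def)
  have pnz: "p \<noteq> 0" using monic by auto
  have degp: "degree p = degree p1" using p1nz by (simp add: p_def)
  have "p = [:inverse (lead_coeff p1):] * p1" by (simp add: p_def)
  then have Rp: "R p" using p1 unfolding P_def R_def by (simp only: of_rat_poly_mult poly_mult) simp
  have dvdI: "p dvd q" if "R q" for q
  proof -
    have "q = p * (q div p) + q mod p" by simp
    then have "of_rat_poly q = of_rat_poly p * of_rat_poly (q div p) + of_rat_poly (q mod p)"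
      by (metis of_rat_poly_add of_rat_poly_mult)
    then have Rm: "R (q mod p)" using that Rp unfolding R_def by simp
    have "q mod p = 0"
    proof (rule ccontr)
      assume nz: "q mod p \<noteq> 0"
      then have "degree p1 \<le> degree (q mod p)" using least Rm by (simp add: P_def)
      moreover have "degree (q mod p) < degree p" using degree_mod_less[OF pnz, of q] nz by blast
      ultimately show False using degp by simp
    qed
    then show ?thesis by (simp add: dvd_eq_mod_eq_0)
  qed
  have nonunit: "\<not> is_unit p"
  proof
    assume "is_unit p"
    then have "degree p = 0" by (simp add: is_unit_iff_degree pnz)
    with monic have "p = 1" by (metis monic_degree_0)
    with Rp show False by (simp add: R_def)
  qed
  have irr: "irreducible p"
  proof (rule irreducibleI)
    fix a b assume ab: "p = a * b"
    then have "R a \<or> R b" using Rp unfolding R_def by (simp add: of_rat_poly_mult)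
    then have "p dvd a \<or> p dvd b" using dvdI by blast
    then show "is_unit a \<or> is_unit b"
      using ab pnz by (metis dvd_mult_cancel_left dvd_mult_cancel_right mult.right_neutral
          mult.left_neutral mult_eq_0_iff)
  qed (use pnz nonunit in auto)
  show ?thesis
  proof
    show "is_min_poly \<alpha> p" using monic irr Rp by (simp add: is_min_poly_def R_def)
  next
    fix q assume q: "is_min_poly \<alpha> q"
    then have "p dvd q" using dvdI by (simp add: is_min_poly_def R_def)
    then obtain c where c: "q = p * c" by (rule dvdE)
    then have "is_unit c" using q nonunit by (auto simp: is_min_poly_def dest: irreducibleD)
    moreover have "c \<noteq> 0" using \<open>is_unit c\<close> by auto
    ultimately have "degree c = 0" by (simp add: is_unit_iff_degree)
    moreover have "lead_coeff c = 1" using q c monic by (simp add: is_min_poly_def lead_coeff_mult)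
    ultimately show "q = p" using c by (metis monic_degree_0 mult.right_neutral)
  qed
qed

end

(* If q and d are coprime integer polynomials, q monic, deg d < deg q = n, and q alternates in sign at
   n + 1 points of [0, oo) at which |q| >= 2 |d|, then q = y d has n positive real roots for every
   y in (-2, 2). Substituting for y the conjugates of infinitely many totally real algebraic integers
   in (-2, 2), here the roots of the iterates of y^2 - 2, yields infinitely many pairwise coprime
   monic integer polynomials whose roots are all positive and whose trace is tr(q) / n times their
   degree; each of them has an irreducible factor of no larger ratio. It then suffices to exhibit one
   pair with tr(q) / n < 1.89831. In terms of the limiting root distribution mu, poles of q / d with
   d = prod Q_j^(k_j) permit log-potentials that are only bounded below by a multiple of
   sum k_j log |Q_j|, and this is what pushes the ratio below 2. *)

theory Submission
  imports Defs
begin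

section \<open>Integer polynomials over larger rings, and Vieta's formula for the sum of the
  roots\<close>

abbreviation of_int_poly :: "int poly \<Rightarrow> 'a :: {comm_ring_1, ring_char_0} poly" where
  "of_int_poly \<equiv> map_poly of_int"

lemma of_int_poly_mult: "of_int_poly (p * q) = of_int_poly p * of_int_poly q"
  by (rule poly_eqI) (simp add: coeff_map_poly coeff_mult)

lemma of_int_poly_add: "of_int_poly (p + q) = of_int_poly p + of_int_poly q"
  by (rule poly_eqI) (simp add: coeff_map_poly)

lemma of_int_poly_diff: "of_int_poly (p - q) = of_int_poly p - of_int_poly q"
  by (rule poly_eqI) (simp add: coeff_map_poly)

lemma of_int_poly_smult: "of_int_poly (smult c p) = smult (of_int c) (of_int_poly p)"
  by (rule poly_eqI) (simp add: coeff_map_poly)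

lemma of_int_poly_power: "of_int_poly (p ^ n) = of_int_poly p ^ n"
  by (induction n) (simp_all add: of_int_poly_mult)

lemma degree_of_int_poly [simp]:
  "degree (of_int_poly p :: 'a :: {comm_ring_1, ring_char_0} poly) = degree p"
  by (rule degree_map_poly) simp

lemma poly_of_int_poly_of_real:
  "poly (of_int_poly p) (of_real x :: complex) = of_real (poly (of_int_poly p) x)"
  by (induction p) (auto simp: map_poly_pCons)

lemma prod_mset_linear_monic:
  fixes A :: "'a :: comm_ring_1 multiset"
  shows "degree (\<Prod>x\<in>#A. [:-x, 1:]) \<le> size A" "coeff (\<Prod>x\<in>#A. [:-x, 1:]) (size A) = 1"
proof (induction A)
  case (add a A)
  {
    case 1
    show ?case
      using degree_mult_le[of "[:-a, 1:]" "\<Prod>x\<in>#A. [:-x, 1:]"] add(1) by simp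
  next
    case 2
    show ?case
      using add by (simp add: coeff_eq_0)
  }
qed simp_all

text \<open>The empty multiset is excluded because \<open>size A - 1\<close> truncates to 0 there,
  where the empty product has coefficient 1.\<close>

lemma coeff_prod_mset_linear:
  fixes A :: "'a :: comm_ring_1 multiset"
  assumes "A \<noteq> {#}"
  shows "coeff (\<Prod>x\<in>#A. [:-x, 1:]) (size A - 1) = - (\<Sum>x\<in>#A. x)"
  using assms
proof (induction A)
  case (add a A)
  have "coeff (\<Prod>x\<in>#A. [:-x, 1:]) (size A) = 1"
    by (rule prod_mset_linear_monic)
  then show ?case
    using add by (cases "size A"; cases "A = {#}") (auto simp: algebra_simps)
qed simp

lemma sum_proots_monic:
  fixes p :: "complex poly"
  assumes "lead_coeff p = 1" "degree p > 0"
  shows "(\<Sum>z\<in>#proots p. z) = - coeff p (degree p - 1)"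
proof -
  have "p = (\<Prod>z\<in>#proots p. [:-z, 1:])"
    using complex_poly_decompose_multiset[of p] assms by simp
  moreover have "proots p \<noteq> {#}"
    using assms size_proots_complex[of p] by auto
  ultimately show ?thesis
    using coeff_prod_mset_linear[of "proots p"] size_proots_complex[of p] by simp
qed

section \<open>Minimal polynomials and the passage to an irreducible factor of small trace\<close>

lemma min_poly:
  assumes "algebraic_int \<alpha>"
  shows "lead_coeff (min_poly \<alpha>) = 1" "irreducible (min_poly \<alpha>)"
    "poly (of_rat_poly (min_poly \<alpha>)) \<alpha> = 0"
  using theI'[OF ex1_is_min_poly[OF assms]] by (auto simp: min_poly_def is_min_poly_def)

text \<open>A nonzero polynomial \<open>g\<close> of least degree vanishing at \<alpha> divides all
  others, by division with remainder. Irreducibility then makes \<open>min_poly \<alpha>\<close> a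
  unit multiple of \<open>g\<close>.\<close>

lemma min_poly_dvd:
  assumes "algebraic_int \<alpha>" "poly (of_rat_poly p) \<alpha> = 0"
  shows "min_poly \<alpha> dvd p"
proof -
  define R where "R g \<longleftrightarrow> poly (of_rat_poly g) \<alpha> = 0" for g
  note m = min_poly[OF assms(1), folded R_def]
  have "min_poly \<alpha> \<noteq> 0 \<and> R (min_poly \<alpha>)"
    using m by auto
  then obtain g where g: "g \<noteq> 0" "R g"
    and least: "\<And>h. h \<noteq> 0 \<Longrightarrow> R h \<Longrightarrow> degree g \<le> degree h"
    using ex_has_least_nat[of "\<lambda>g. g \<noteq> 0 \<and> R g" _ degree] by blast
  have g_dvd: "g dvd h" if "R h" for h
  proof -
    have "of_rat_poly h = of_rat_poly g * of_rat_poly (h div g) + (of_rat_poly (h mod g) :: complex poly)"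
      by (metis of_rat_poly_add of_rat_poly_mult mult_div_mod_eq)
    then have "R (h mod g)"
      using that g(2) by (simp add: R_def)
    then have "h mod g = 0"
      using least[of "h mod g"] degree_mod_less[OF g(1), of h] by linarith
    then show ?thesis
      by (simp add: dvd_eq_mod_eq_0)
  qed
  obtain c where c: "min_poly \<alpha> = g * c"
    using g_dvd[OF m(3)] by (rule dvdE)
  have "\<not> is_unit g"
  proof
    assume "is_unit g"
    then have "g dvd 1" by simp
    then obtain h where h: "1 = g * h" by (rule dvdE)
    have "of_rat_poly (g * h) = (1 :: complex poly)"
      unfolding h[symmetric] by simp
    then have "poly (of_rat_poly g * of_rat_poly h) \<alpha> = 1"
      by (simp only: of_rat_poly_mult poly_1)
    then show False using g(2) by (simp add: R_def)
  qed
  then have "is_unit c"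
    using irreducibleD[OF m(2) c] by blast
  then have "min_poly \<alpha> dvd g"
    by (simp add: c mult_unit_dvd_iff)
  then show ?thesis
    using g_dvd[of p] assms(2) dvd_trans by (auto simp: R_def)
qed

lemma degree_of_rat_poly: "degree (of_rat_poly p) = degree p"
  by (rule degree_map_poly) simp

text \<open>Averaging: in \<open>p = m * r\<close> with \<open>m\<close> a minimal polynomial,
  traces and degrees add. If the ratio of \<open>m\<close> exceeds \<open>c\<close>, that of
  \<open>r\<close> lies below \<open>c\<close>, and induction on the degree applies to
  \<open>r\<close>.\<close>

lemma ex_small_trace_root:
  fixes p :: "rat poly" and c :: real
  assumes "lead_coeff p = 1" "degree p > 0"
    and "\<And>z. poly (of_rat_poly p) z = 0 \<Longrightarrow> algebraic_int z \<and> z \<in> \<real> \<and> Re z > 0"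
    and "Re (\<Sum>z\<in>#proots (of_rat_poly p). z) \<le> c * degree p"
  shows "\<exists>\<alpha>. poly (of_rat_poly p) \<alpha> = 0 \<and> totally_positive \<alpha> \<and>
           Re (alg_trace \<alpha>) \<le> c * alg_degree \<alpha>"
  using assms
proof (induction "degree p" arbitrary: p rule: less_induct)
  case less
  have "\<not> constant (poly (of_rat_poly p))"
    using less.prems(2) by (simp add: constant_degree degree_of_rat_poly)
  then obtain \<alpha> where \<alpha>: "poly (of_rat_poly p) \<alpha> = 0"
    using fundamental_theorem_of_algebra by blast
  have int: "algebraic_int \<alpha>" using less.prems(3) \<alpha> by blast
  define m where "m = min_poly \<alpha>"
  note m = min_poly[OF int, folded m_def]
  obtain r where r: "p = m * r"
    using min_poly_dvd[OF int \<alpha>] by (auto simp: m_def)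
  have p0: "p \<noteq> 0" using less.prems(1) by auto
  then have m0: "m \<noteq> 0" and r0: "r \<noteq> 0" using r by auto
  have c0: "of_rat_poly m * of_rat_poly r \<noteq> 0"
    using m0 r0 by (simp add: map_poly_eq_0_iff)
  have lr: "lead_coeff r = 1"
    using less.prems(1) m(1) by (simp add: r lead_coeff_mult)
  have deg: "degree p = degree m + degree r"
    using m0 r0 by (simp add: r degree_mult_eq)
  have dm: "degree m > 0"
    using m(1,3) monic_degree_0[of m] by (cases "degree m = 0") auto
  have roots: "proots (of_rat_poly p) = proots (of_rat_poly m) + proots (of_rat_poly r)"
    using c0 by (simp add: r of_rat_poly_mult proots_mult)
  have root_m: "poly (of_rat_poly m) z = 0 \<Longrightarrow> poly (of_rat_poly p) z = 0"
    and root_r: "poly (of_rat_poly r) z = 0 \<Longrightarrow> poly (of_rat_poly p) z = 0" for z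
    by (simp_all add: r of_rat_poly_mult)
  have "z \<in> \<real> \<and> Re z > 0" if "z \<in># conjugates \<alpha>" for z
  proof -
    have "poly (of_rat_poly m) z = 0"
      using that c0 by (simp add: conjugates_def m_def[symmetric])
    then show ?thesis using less.prems(3) root_m by blast
  qed
  then have tp: "totally_positive \<alpha>"
    using int by (simp add: totally_positive_def)
  show ?case
  proof (cases "Re (alg_trace \<alpha>) \<le> c * alg_degree \<alpha>")
    case True
    with \<alpha> tp show ?thesis by blast
  next
    case False
    then have "Re (\<Sum>z\<in>#proots (of_rat_poly r). z) < c * degree r"
      using less.prems(4) deg
      by (simp add: alg_trace_def alg_degree_def conjugates_def m_def[symmetric] roots algebra_simps)
    note trace_r = this
    \<comment> \<open>In degree 0 the monic \<open>r\<close> is 1 and has no roots, so the strict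
      inequality would read 0 < 0.\<close>
    have "degree r > 0"
      using lr monic_degree_0[of r] trace_r by (cases "degree r = 0") auto
    have "\<exists>\<alpha>. poly (of_rat_poly r) \<alpha> = 0 \<and> totally_positive \<alpha> \<and>
           Re (alg_trace \<alpha>) \<le> c * alg_degree \<alpha>"
    proof (rule less.hyps)
      show "degree r < degree p" using deg dm by simp
      show "algebraic_int z \<and> z \<in> \<real> \<and> Re z > 0" if "poly (of_rat_poly r) z = 0" for z
        using less.prems(3)[OF root_r[OF that]] .
    qed (use lr trace_r \<open>degree r > 0\<close> in simp_all)
    with root_r show ?thesis by blast
  qed
qed

section \<open>Sign alternation and positivity of all roots\<close>

text \<open>A division-free form of |f / g| \<ge> 2, so that points may be zeros of
  \<open>g\<close>. The constant 2 belongs to the interval [-2, 2], which y^2 - 2 maps onto itself.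
  There are \<open>n\<close> sign changes between \<open>n + 1\<close> points.\<close>

definition alternates :: "real poly \<Rightarrow> real poly \<Rightarrow> nat \<Rightarrow> bool" where
  "alternates f g n \<longleftrightarrow> (\<exists>x. 0 \<le> x 0 \<and>
     (\<forall>i<n. x i < x (Suc i) \<and> poly f (x i) * poly f (x (Suc i)) < 0) \<and>
     (\<forall>i\<le>n. 2 * \<bar>poly g (x i)\<bar> \<le> \<bar>poly f (x i)\<bar>))"

text \<open>The map y^2 - 2, applied to f / g, sends |y| \<ge> 2 to values at least 2 and sends 0 to
  -2. So the old points together with one root of \<open>f\<close> in each gap alternate again, with
  the same bound 2.\<close>

lemma alternates_double:
  assumes "alternates f g n" "\<And>t. poly f t = 0 \<Longrightarrow> poly g t \<noteq> 0"
  shows "alternates (f ^ 2 - smult 2 (g ^ 2)) (g ^ 2) (2 * n)"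
proof -
  obtain x where x0: "0 \<le> x 0"
    and x: "\<And>i. i < n \<Longrightarrow> x i < x (Suc i)"
    and sgn: "\<And>i. i < n \<Longrightarrow> poly f (x i) * poly f (x (Suc i)) < 0"
    and big: "\<And>i. i \<le> n \<Longrightarrow> 2 * \<bar>poly g (x i)\<bar> \<le> \<bar>poly f (x i)\<bar>"
    using assms(1) unfolding alternates_def by blast
  have "\<exists>z. \<forall>i<n. x i < z i \<and> z i < x (Suc i) \<and> poly f (z i) = 0"
    using poly_IVT[OF x sgn] by (intro choice) blast
  then obtain z where z: "\<And>i. i < n \<Longrightarrow> x i < z i" "\<And>i. i < n \<Longrightarrow> z i < x (Suc i)"
    "\<And>i. i < n \<Longrightarrow> poly f (z i) = 0"
    by blast
  define F where "F t = (poly f t)\<^sup>2 - 2 * (poly g t)\<^sup>2" for t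
  have sq: "4 * (poly g (x i))\<^sup>2 \<le> (poly f (x i))\<^sup>2" if "i \<le> n" for i
    using power_mono[OF big[OF that], of 2] by (simp add: power_mult_distrib)
  have Fx: "F (x i) > 0" if "i \<le> n" "n > 0" for i
  proof -
    have "poly f (x i) \<noteq> 0"
    proof (cases "i < n")
      case True
      then show ?thesis using sgn[of i] by auto
    next
      case False
      \<comment> \<open>The last point has no successor, so the sign condition of the preceding pair
        is used.\<close>
      then have "i = Suc (n - 1)" using that by simp
      then show ?thesis using sgn[of "n - 1"] that by auto
    qed
    then have "(poly f (x i))\<^sup>2 > 0" by simp
    then show ?thesis using sq[OF that(1)] unfolding F_def by linarith
  qed
  have Fz: "F (z i) = - 2 * (poly g (z i))\<^sup>2" "F (z i) < 0" if "i < n" for i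
    using z(3)[OF that] assms(2) by (simp_all add: F_def)
  \<comment> \<open>The new polynomial is positive at the old points and negative at the roots of \<open>f\<close> between them.\<close>
  define y where "y j = (if even j then x (j div 2) else z (j div 2))" for j
  have "0 \<le> y 0" using x0 by (simp add: y_def)
  moreover have "y j < y (Suc j) \<and> F (y j) * F (y (Suc j)) < 0" if "j < 2 * n" for j
  proof (cases "even j")
    case True
    then obtain k where "j = 2 * k" by blast
    then show ?thesis using that z[of k] Fx[of k] Fz[of k] by (simp add: y_def mult_less_0_iff)
  next
    case False
    then obtain k where "j = 2 * k + 1" by (elim oddE)
    then show ?thesis using that z[of k] Fx[of "Suc k"] Fz[of k] by (simp add: y_def mult_less_0_iff)
  qed
  moreover have "2 * \<bar>(poly g (y j))\<^sup>2\<bar> \<le> \<bar>F (y j)\<bar>" if "j \<le> 2 * n" for j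
  proof (cases "even j")
    case True
    then show ?thesis using that sq[of "j div 2"] by (auto simp: y_def F_def)
  next
    case False
    then obtain k where "j = 2 * k + 1" by (elim oddE)
    then show ?thesis using that Fz(1)[of k] by (simp add: y_def)
  qed
  ultimately show ?thesis
    unfolding alternates_def by (intro exI[of _ y]) (simp add: F_def)
qed

text \<open>Each sign change gives a root to the right of \<open>x 0\<close>. These are as many
  distinct positive roots as the degree, so no other complex root exists.\<close>

lemma alternates_imp_roots_pos:
  assumes "alternates (of_int_poly p) g (degree p)" "p \<noteq> 0"
    and "poly (of_int_poly p) (z :: complex) = 0"
  shows "z \<in> \<real> \<and> Re z > 0"
proof -
  define n where "n = degree p"
  define f where "f = (of_int_poly p :: real poly)"
  obtain x where x0: "0 \<le> x 0"
    and x: "\<And>i. i < n \<Longrightarrow> x i < x (Suc i)"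
    and sgn: "\<And>i. i < n \<Longrightarrow> poly f (x i) * poly f (x (Suc i)) < 0"
    using assms(1) unfolding alternates_def n_def f_def by blast
  have "\<exists>t. \<forall>i<n. x i < t i \<and> t i < x (Suc i) \<and> poly f (t i) = 0"
    using poly_IVT[OF x sgn] by (intro choice) blast
  then obtain t where t: "\<And>i. i < n \<Longrightarrow> x i < t i" "\<And>i. i < n \<Longrightarrow> t i < x (Suc i)"
    "\<And>i. i < n \<Longrightarrow> poly f (t i) = 0"
    by blast
  have mono: "i < j \<Longrightarrow> j < n \<Longrightarrow> t i < t j" for i j
  proof (induction j)
    case (Suc j)
    have "t j < t (Suc j)" using t(2)[of j] t(1)[of "Suc j"] Suc.prems by simp
    with Suc show ?case by (cases "i = j") auto
  qed simp
  have pos: "0 < t i" if "i < n" for i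
    using t(1)[of 0] x0 mono[of 0 i] that by (cases "i = 0") auto
  have inj: "inj_on (\<lambda>i. complex_of_real (t i)) {..<n}"
    by (rule inj_onI) (metis lessThan_iff mono nat_neq_iff of_real_eq_iff order_less_irrefl)
  define R where "R = {z. poly (of_int_poly p) (z :: complex) = 0}"
  have p0: "(of_int_poly p :: complex poly) \<noteq> 0"
    using assms(2) by (simp add: map_poly_eq_0_iff)
  have "(\<lambda>i. complex_of_real (t i)) ` {..<n} = R"
  proof (rule card_seteq)
    show "finite R" using p0 by (simp add: R_def poly_roots_finite)
    show "(\<lambda>i. complex_of_real (t i)) ` {..<n} \<subseteq> R"
      using t(3) by (auto simp: R_def poly_of_int_poly_of_real f_def)
    show "card R \<le> card ((\<lambda>i. complex_of_real (t i)) ` {..<n})"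
      using card_poly_roots_bound[OF p0] unfolding R_def card_image[OF inj] by (simp add: n_def)
  qed
  moreover have "z \<in> R" using assms(3) by (simp add: R_def)
  ultimately obtain i where "i < n" "z = of_real (t i)" by blast
  then show ?thesis using pos by simp
qed


section \<open>Iterating y^2 - 2 on the quotient q / d\<close>

lemma power_two_power_Suc: "(x :: 'a :: monoid_mult) ^ 2 ^ Suc m = (x ^ 2 ^ m)\<^sup>2"
  by (simp only: power_Suc2 power_mult)

text \<open>The polynomial \<open>d\<^bsup>2^m\<^esup> f\<^sup>m(q / d)\<close>, where \<open>f(y) = y\<^sup>2 - 2\<close>.\<close>

fun homogenized_iterate :: "int poly \<Rightarrow> int poly \<Rightarrow> nat \<Rightarrow> int poly" where
  "homogenized_iterate q d 0 = q"
| "homogenized_iterate q d (Suc m) = homogenized_iterate q d m ^ 2 - smult 2 (d ^ 2 ^ Suc m)"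

text \<open>The degree bound keeps \<open>e\<close> away from the two top coefficients of
  \<open>a ^ 2\<close>, which determine degree and trace.\<close>

lemma monic_square_diff:
  fixes a e :: "'a :: idom poly"
  assumes "lead_coeff a = 1" "degree e + 2 \<le> 2 * degree a"
  shows "lead_coeff (a ^ 2 - e) = 1" "degree (a ^ 2 - e) = 2 * degree a"
    "coeff (a ^ 2 - e) (2 * degree a - 1) = 2 * coeff a (degree a - 1)"
proof -
  define n where "n = degree a"
  \<comment> \<open>With a = X^n + b, the square b^2 has degree at most 2n - 2, so only X^(2n) + 2
    X^n b reaches the two top coefficients.\<close>
  define b where "b = a - monom 1 n"
  have n: "n > 0" using assms(2) by (simp add: n_def)
  have "degree b \<le> n" unfolding b_def
    by (intro degree_diff_le) (simp_all add: n_def degree_monom_le)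
  moreover have "coeff b n = 0"
    using assms(1) by (simp add: b_def n_def)
  then have "degree b \<noteq> n"
    using n by (metis degree_0 leading_coeff_0_iff less_irrefl)
  ultimately have db: "degree b \<le> n - 1"
    by linarith
  define M where "M = (monom 1 n :: 'a poly)"
  have "a = M + b"
    by (simp add: b_def M_def)
  then have "a ^ 2 = M * M + (M * b + M * b) + b ^ 2"
    by (simp add: power2_eq_square distrib_left distrib_right mult.commute[of b M])
  then have a: "a ^ 2 = monom 1 (2 * n) + (monom 1 n * b + monom 1 n * b) + b ^ 2"
    by (simp only: M_def mult_monom mult_1 mult_2)
  have sq: "coeff (a ^ 2) k =
      (if k = 2 * n then 1 else 0) + 2 * (if k < n then 0 else coeff b (k - n)) + coeff (b ^ 2) k" for k
    unfolding a by (simp only: coeff_add coeff_monom_mult mult_2 coeff_monom) simp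
  have "degree (b ^ 2) \<le> 2 * (n - 1)"
    using degree_power_le[of b 2] db by simp
  then have b2: "coeff (b ^ 2) k = 0" if "k \<ge> 2 * n - 1" for k
    using that n by (intro coeff_eq_0) linarith
  have e0: "coeff e k = 0" if "k \<ge> 2 * n - 1" for k
    using that assms(2) by (intro coeff_eq_0) (simp add: n_def)
  have bn: "coeff b k = 0" if "k \<ge> n" for k
    using that db n by (intro coeff_eq_0) linarith
  have top: "coeff (a ^ 2 - e) (2 * n) = 1"
    using n b2[of "2 * n"] e0[of "2 * n"] bn[of n] by (simp add: sq)
  have "coeff (a ^ 2 - e) k = 0" if "k > 2 * n" for k
    using that b2[of k] e0[of k] bn[of "k - n"] by (simp add: sq)
  then have "degree (a ^ 2 - e) \<le> 2 * n" by (intro degree_le) simp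
  moreover have "2 * n \<le> degree (a ^ 2 - e)" using top by (intro le_degree) simp
  ultimately show deg: "degree (a ^ 2 - e) = 2 * degree a" by (simp add: n_def)
  show "lead_coeff (a ^ 2 - e) = 1" using top deg by (simp add: n_def)
  have idx: "2 * n - 1 \<noteq> 2 * n" "\<not> 2 * n - 1 < n" "2 * n - 1 - n = n - 1"
    using n by arith+
  have "coeff b (n - 1) = coeff a (n - 1)"
    using n by (simp add: b_def)
  then show "coeff (a ^ 2 - e) (2 * degree a - 1) = 2 * coeff a (degree a - 1)"
    unfolding n_def[symmetric] coeff_diff sq b2[OF order_refl] e0[OF order_refl] using idx by simp
qed

text \<open>Excluding real common roots suffices, since every root of every iterate turns out to be
  real.\<close>

locale certificate =
  fixes q d :: "int poly"
  assumes monic: "lead_coeff q = 1"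
    and degree_less: "degree d < degree q"
    and no_common_root: "\<And>t :: real. poly (of_int_poly q) t = 0 \<Longrightarrow> poly (of_int_poly d) t \<noteq> 0"
    and alternates: "alternates (of_int_poly q) (of_int_poly d) (degree q)"
begin

abbreviation "iter \<equiv> homogenized_iterate q d"

text \<open>Degree and trace both double at each step, so their ratio stays that of
  \<open>q\<close>.\<close>

lemma iter_coeffs:
  "lead_coeff (iter m) = 1 \<and> degree (iter m) = 2 ^ m * degree q \<and>
   coeff (iter m) (degree (iter m) - 1) = 2 ^ m * coeff q (degree q - 1)"
proof (induction m)
  case (Suc m)
  have "degree (smult 2 (d ^ 2 ^ Suc m)) + 2 \<le> 2 * degree (iter m)"
  proof -
    have "degree (smult 2 (d ^ 2 ^ Suc m)) \<le> degree d * 2 ^ Suc m"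
      using degree_smult_le degree_power_le order_trans by blast
    \<comment> \<open>The gap of at least 1 between the degrees of \<open>d\<close> and
      \<open>q\<close> grows to at least \<open>2 ^ Suc m\<close>; a gap of 2 already protects the
      trace coefficient.\<close>
    moreover have "(2 :: nat) \<le> 2 ^ Suc m"
      by simp
    ultimately have "degree (smult 2 (d ^ 2 ^ Suc m)) + 2 \<le> degree d * 2 ^ Suc m + 2 ^ Suc m"
      by (rule add_mono)
    also have "\<dots> = (degree d + 1) * 2 ^ Suc m"
      by (simp only: distrib_right mult_1)
    also have "\<dots> \<le> degree q * 2 ^ Suc m"
      using degree_less by (intro mult_right_mono) auto
    also have "\<dots> = 2 * degree (iter m)"
      using Suc by simp
    finally show ?thesis .
  qed
  note step = monic_square_diff[OF conjunct1[OF Suc] this, folded homogenized_iterate.simps]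
  have "degree (iter (Suc m)) = 2 * degree (iter m)" by (rule step(2))
  moreover have "coeff (iter m) (degree (iter m) - 1) = 2 ^ m * coeff q (degree q - 1)"
    and "degree (iter m) = 2 ^ m * degree q"
    using Suc by blast+
  ultimately have "degree (iter (Suc m)) = 2 ^ Suc m * degree q"
    "coeff (iter (Suc m)) (2 * degree (iter m) - 1) = 2 ^ Suc m * coeff q (degree q - 1)"
    using step(3) by (simp_all only: power_Suc mult.assoc)
  with step(1) \<open>degree (iter (Suc m)) = 2 * degree (iter m)\<close> show ?case
    by (simp only:)
qed (simp add: monic)

lemma poly_iter_Suc:
  "poly (of_int_poly (iter (Suc m))) t =
     (poly (of_int_poly (iter m)) t)\<^sup>2 - 2 * (poly (of_int_poly d) t) ^ 2 ^ Suc m"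
  by (simp only: homogenized_iterate.simps of_int_poly_diff of_int_poly_smult of_int_poly_power)
     simp

text \<open>At a zero of \<open>d\<close> each step of the recursion is plain squaring, so a common
  root would descend to \<open>q\<close>.\<close>

lemma iter_no_common_root:
  "poly (of_int_poly (iter m)) (t :: real) = 0 \<Longrightarrow> poly (of_int_poly d) t \<noteq> 0"
proof (induction m)
  case 0
  then show ?case using no_common_root by simp
next
  case (Suc m)
  then show ?case by (auto simp: poly_iter_Suc zero_power simp del: homogenized_iterate.simps)
qed

lemma iter_alternates:
  "alternates (of_int_poly (iter m)) (of_int_poly d ^ 2 ^ m) (degree (iter m))"
proof (induction m)
  case 0
  then show ?case using alternates by simp
next
  case (Suc m)
  have "alternates (of_int_poly (iter m) ^ 2 - smult 2 ((of_int_poly d ^ 2 ^ m) ^ 2))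
          ((of_int_poly d ^ 2 ^ m) ^ 2) (2 * degree (iter m))"
    using iter_no_common_root by (intro alternates_double[OF Suc]) simp
  moreover have "2 * degree (iter m) = degree (iter (Suc m))"
    using iter_coeffs[of m] iter_coeffs[of "Suc m"] by simp
  ultimately show ?case
    by (simp only: homogenized_iterate.simps of_int_poly_diff of_int_poly_smult of_int_poly_power
        power_two_power_Suc of_int_numeral)
qed

text \<open>The orbit of 0 under y^2 - 2 is 0, -2, 2, 2, ... and never returns to 0. In homogenized
  form these values carry powers of \<open>e\<close>, the nonzero value of \<open>d\<close> at
  \<open>t\<close>.\<close>

lemma iter_roots_disjoint:
  assumes "poly (of_int_poly (iter m)) (t :: real) = 0" "m < k"
  shows "poly (of_int_poly (iter k)) t \<noteq> 0"
proof -
  define e where "e = poly (of_int_poly d) t"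
  have e: "e \<noteq> 0" using iter_no_common_root assms(1) by (simp add: e_def)
  have 1: "poly (of_int_poly (iter (Suc m))) t = - 2 * e ^ 2 ^ Suc m"
    using assms(1) by (simp only: poly_iter_Suc e_def) simp
  have "poly (of_int_poly (iter (m + 2 + j))) t = 2 * e ^ 2 ^ (m + 2 + j)" for j
  proof (induction j)
    case 0
    have "poly (of_int_poly (iter (Suc (Suc m)))) t = 2 * e ^ 2 ^ Suc (Suc m)"
      unfolding poly_iter_Suc[of "Suc m"] 1 e_def[symmetric] power_two_power_Suc[of e "Suc m"]
      by (simp add: power_mult_distrib)
    then show ?case by simp
  next
    case (Suc j)
    have "poly (of_int_poly (iter (Suc (m + 2 + j)))) t = 2 * e ^ 2 ^ Suc (m + 2 + j)"
      unfolding poly_iter_Suc[of "m + 2 + j"] Suc e_def[symmetric] power_two_power_Suc[of e "m + 2 + j"]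
      by (simp add: power_mult_distrib)
    then show ?case by simp
  qed
  moreover have "k = Suc m \<or> k = m + 2 + (k - m - 2)" using assms(2) by auto
  ultimately show ?thesis using e 1 by (metis mult_eq_0_iff neg_equal_0_iff_equal power_not_zero zero_neq_numeral)
qed

text \<open>The factor in front of \<open>alg_degree \<alpha>\<close> is the trace of
  \<open>q\<close> over its degree, shared by all iterates; averaging over the irreducible factors
  of \<open>iter m\<close> yields \<alpha>.\<close>

lemma ex_small_trace_conjugate:
  "\<exists>\<alpha>. poly (of_int_poly (iter m)) \<alpha> = 0 \<and> totally_positive \<alpha> \<and>
     Re (alg_trace \<alpha>) \<le> - real_of_int (coeff q (degree q - 1)) / degree q * alg_degree \<alpha>"
proof -
  define p where "p = (of_int_poly (iter m) :: rat poly)"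
  have cp: "of_rat_poly p = of_int_poly (iter m)"
    by (rule poly_eqI) (simp add: p_def coeff_map_poly)
  note it = iter_coeffs[of m]
  have "lead_coeff p = of_int (lead_coeff (iter m))"
    by (simp add: p_def coeff_map_poly)
  then have monic_p: "lead_coeff p = 1"
    using it by (metis of_int_1)
  have deg0: "degree q > 0" using degree_less by simp
  have degp: "degree p = 2 ^ m * degree q" "degree p > 0"
    using it deg0 by (simp_all add: p_def)
  have roots: "algebraic_int z \<and> z \<in> \<real> \<and> Re z > 0" if "poly (of_rat_poly p) z = 0" for z
  proof -
    have "algebraic_int z"
      using that it unfolding cp algebraic_int_altdef_ipoly by blast
    moreover have "iter m \<noteq> 0" using it by auto
    ultimately show ?thesis
      using alternates_imp_roots_pos[OF iter_alternates] that unfolding cp by blast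
  qed
  have "(\<Sum>z\<in>#proots (of_rat_poly p). z) = - coeff (of_rat_poly p) (degree (of_rat_poly p) - 1)"
    using monic_p degp by (intro sum_proots_monic) (simp_all add: degree_of_rat_poly coeff_map_poly)
  also have "\<dots> = - of_int (coeff (iter m) (degree (iter m) - 1))"
    by (simp add: cp coeff_map_poly)
  also have "\<dots> = - of_int (2 ^ m * coeff q (degree q - 1))"
    using it by (metis (no_types))
  finally have trace: "Re (\<Sum>z\<in>#proots (of_rat_poly p). z) =
      - real_of_int (coeff q (degree q - 1)) / degree q * degree p"
    using deg0 by (simp add: degp)
  show ?thesis
    using ex_small_trace_root[OF monic_p degp(2) roots eq_refl[OF trace]] unfolding cp .
qed

text \<open>One number is chosen from each iterate; all are real, and distinct iterates share no
  real root.\<close>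

lemma infinite_small_trace:
  "infinite {\<alpha>. totally_positive \<alpha> \<and>
     Re (alg_trace \<alpha>) \<le> - real_of_int (coeff q (degree q - 1)) / degree q * alg_degree \<alpha>}"
    (is "infinite ?S")
proof -
  obtain \<alpha> where root: "\<And>m. poly (of_int_poly (iter m)) (\<alpha> m) = 0"
    and mem: "\<And>m. \<alpha> m \<in> ?S"
    using ex_small_trace_conjugate by (simp only: mem_Collect_eq) metis
  have "\<alpha> m \<noteq> \<alpha> k" if "m < k" for m k
  proof
    assume eq: "\<alpha> m = \<alpha> k"
    have "iter m \<noteq> 0" using iter_coeffs[of m] by auto
    then have "\<alpha> m \<in> \<real>"
      using alternates_imp_roots_pos[OF iter_alternates] root by blast
    then obtain t where "\<alpha> m = of_real t" by (elim Reals_cases)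
    then show False
      using root[of m] root[of k] eq iter_roots_disjoint[OF _ that, of t]
      by (simp add: poly_of_int_poly_of_real)
  qed
  then have "inj \<alpha>"
    by (metis injI nat_neq_iff)
  then have "infinite (range \<alpha>)"
    by (rule range_inj_infinite)
  moreover have "range \<alpha> \<subseteq> ?S"
    using mem by (rule image_subsetI)
  ultimately show ?thesis
    by (metis finite_subset)
qed

end

section \<open>Existence of the greatest bound and its estimate from above\<close>

lemma Re_sum_mset_nonneg: "(\<And>z. z \<in># A \<Longrightarrow> 0 \<le> Re z) \<Longrightarrow> 0 \<le> Re (\<Sum>z\<in>#A. z)"
  by (induction A) auto

text \<open>Traces of totally positive numbers are nonnegative, so the set in question is empty.
  This makes the set of bounds nonempty when its supremum is taken.\<close>

lemma SSS_bound_0: "SSS_bound 0"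
  unfolding SSS_bound_def
proof (intro allI impI)
  fix \<epsilon> :: real assume "\<epsilon> > 0"
  have "\<not> Re (alg_trace \<alpha>) < (0 - \<epsilon>) * alg_degree \<alpha>" if "totally_positive \<alpha>" for \<alpha>
  proof -
    have "0 \<le> Re (alg_trace \<alpha>)"
      unfolding alg_trace_def using that
      by (intro Re_sum_mset_nonneg) (auto simp: totally_positive_def less_imp_le)
    moreover have "(0 - \<epsilon>) * alg_degree \<alpha> \<le> 0"
      using \<open>\<epsilon> > 0\<close> by (simp add: mult_nonneg_nonneg)
    ultimately show ?thesis by linarith
  qed
  then have "{\<alpha>. totally_positive \<alpha> \<and> Re (alg_trace \<alpha>) < (0 - \<epsilon>) * alg_degree \<alpha>} = {}"
    by blast
  then show "finite {\<alpha>. totally_positive \<alpha> \<and> Re (alg_trace \<alpha>) < (0 - \<epsilon>) * alg_degree \<alpha>}"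
    by (simp only: finite.emptyI)
qed

lemma alg_degree_pos:
  assumes "algebraic_int \<alpha>"
  shows "alg_degree \<alpha> > 0"
  using min_poly(1,3)[OF assms] monic_degree_0[of "min_poly \<alpha>"]
  by (cases "degree (min_poly \<alpha>) = 0") (auto simp: alg_degree_def)

lemma SSS_bound_le:
  fixes c :: real
  assumes "infinite {\<alpha>. totally_positive \<alpha> \<and> Re (alg_trace \<alpha>) \<le> c * alg_degree \<alpha>}"
    and "SSS_bound \<mu>"
  shows "\<mu> \<le> c"
proof (rule ccontr)
  assume "\<not> \<mu> \<le> c"
  \<comment> \<open>Half the gap keeps \<mu> - \<epsilon> above \<open>c\<close>, turning the weak
    trace inequality into a strict one.\<close>
  define \<epsilon> where "\<epsilon> = (\<mu> - c) / 2"
  have \<epsilon>: "\<epsilon> > 0" "c < \<mu> - \<epsilon>" using \<open>\<not> \<mu> \<le> c\<close> by (simp_all add: \<epsilon>_def field_simps)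
  have "{\<alpha>. totally_positive \<alpha> \<and> Re (alg_trace \<alpha>) \<le> c * alg_degree \<alpha>} \<subseteq>
      {\<alpha>. totally_positive \<alpha> \<and> Re (alg_trace \<alpha>) < (\<mu> - \<epsilon>) * alg_degree \<alpha>}"
  proof safe
    fix \<alpha> assume "totally_positive \<alpha>" and le: "Re (alg_trace \<alpha>) \<le> c * alg_degree \<alpha>"
    then have "alg_degree \<alpha> > 0" by (simp add: totally_positive_def alg_degree_pos)
    then have "c * alg_degree \<alpha> < (\<mu> - \<epsilon>) * alg_degree \<alpha>" using \<epsilon> by (simp add: mult_strict_right_mono)
    with le show "Re (alg_trace \<alpha>) < (\<mu> - \<epsilon>) * alg_degree \<alpha>" by linarith
  qed
  then show False using assms \<epsilon>(1) finite_subset by (auto simp: SSS_bound_def)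
qed

text \<open>The supremum of all bounds is itself a bound, hence the greatest element that
  \<open>GREATEST\<close> selects.\<close>

lemma lambda_SSS_le:
  fixes c :: real
  assumes "infinite {\<alpha>. totally_positive \<alpha> \<and> Re (alg_trace \<alpha>) \<le> c * alg_degree \<alpha>}"
  shows "lambda_SSS \<le> c"
proof -
  define S where "S = Collect SSS_bound"
  define s where "s = Sup S"
  have le: "\<mu> \<le> c" if "SSS_bound \<mu>" for \<mu>
    using SSS_bound_le[OF assms that] .
  then have bdd: "bdd_above S" by (intro bdd_aboveI[of _ c]) (simp add: S_def)
  have ne: "S \<noteq> {}" using SSS_bound_0 by (auto simp: S_def)
  have "SSS_bound (s)"
    unfolding SSS_bound_def
  proof (intro allI impI)
    fix \<epsilon> :: real assume "\<epsilon> > 0"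
    \<comment> \<open>One half of \<epsilon> pays for approximating the supremum, the other half is
      spent on the bound \<mu>.\<close>
    then have "\<exists>\<mu>\<in>S. s - \<epsilon> / 2 < \<mu>"
      using less_cSup_iff[OF ne bdd, of "s - \<epsilon> / 2"] by (simp add: s_def)
    then obtain \<mu> where \<mu>: "SSS_bound \<mu>" "s - \<epsilon> / 2 < \<mu>"
      by (auto simp: S_def)
    have "{\<alpha>. totally_positive \<alpha> \<and> Re (alg_trace \<alpha>) < (s - \<epsilon>) * alg_degree \<alpha>} \<subseteq>
        {\<alpha>. totally_positive \<alpha> \<and> Re (alg_trace \<alpha>) < (\<mu> - \<epsilon> / 2) * alg_degree \<alpha>}"
    proof safe
      fix \<alpha> assume "Re (alg_trace \<alpha>) < (s - \<epsilon>) * alg_degree \<alpha>"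
      also have "\<dots> \<le> (\<mu> - \<epsilon> / 2) * alg_degree \<alpha>"
        using \<mu>(2) by (intro mult_right_mono) auto
      finally show "Re (alg_trace \<alpha>) < (\<mu> - \<epsilon> / 2) * alg_degree \<alpha>" .
    qed
    moreover have "finite {\<alpha>. totally_positive \<alpha> \<and> Re (alg_trace \<alpha>) < (\<mu> - \<epsilon> / 2) * alg_degree \<alpha>}"
      using \<mu>(1) \<open>\<epsilon> > 0\<close> by (simp add: SSS_bound_def)
    ultimately show "finite {\<alpha>. totally_positive \<alpha> \<and> Re (alg_trace \<alpha>) < (s - \<epsilon>) * alg_degree \<alpha>}"
      by (rule finite_subset)
  qed
  then have "lambda_SSS = s"
    unfolding lambda_SSS_def by (rule Greatest_equality) (use bdd in \<open>auto simp: s_def S_def intro: cSup_upper\<close>)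
  also have "\<dots> \<le> c" unfolding s_def using ne le by (intro cSup_least) (auto simp: S_def)
  finally show ?thesis .
qed


section \<open>The explicit pair of polynomials of degrees 29 and 16\<close>

text \<open>A recursive form of the alternation condition that simplification can evaluate at
  rational points. The sign \<open>c\<close>, meant to be 1 or -1, is the expected sign of
  \<open>f\<close> and replaces its absolute value.\<close>

fun alternating_at :: "real poly \<Rightarrow> real poly \<Rightarrow> real \<Rightarrow> real list \<Rightarrow> bool" where
  "alternating_at f g c [] \<longleftrightarrow> True"
| "alternating_at f g c (x # xs) \<longleftrightarrow> 0 < c * poly f x \<and> 2 * \<bar>poly g x\<bar> \<le> c * poly f x \<and>
     (xs = [] \<or> x < hd xs) \<and> alternating_at f g (- c) xs"

lemma alternating_at_nth:
  assumes "alternating_at f g c xs" "\<bar>c\<bar> = 1" "i < length xs"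
  shows "2 * \<bar>poly g (xs ! i)\<bar> \<le> \<bar>poly f (xs ! i)\<bar> \<and> (Suc i < length xs \<longrightarrow>
    xs ! i < xs ! Suc i \<and> poly f (xs ! i) * poly f (xs ! Suc i) < 0)"
  using assms
proof (induction xs arbitrary: c i)
  case (Cons x xs)
  have c: "c = 1 \<or> c = - 1" using Cons.prems(2) by linarith
  show ?case
  proof (cases i)
    case 0
    have "xs = [] \<or> (\<exists>y ys. xs = y # ys)" by (cases xs) auto
    then show ?thesis using Cons.prems(1) c 0 by (auto simp: mult_less_0_iff)
  next
    case (Suc j)
    then show ?thesis using Cons.IH[of "- c" j] Cons.prems by auto
  qed
qed simp

lemma alternating_at_imp_alternates:
  assumes "alternating_at f g c xs" "\<bar>c\<bar> = 1" "length xs = Suc n" "0 \<le> xs ! 0"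
  shows "alternates f g n"
  unfolding alternates_def
  using assms(3,4) alternating_at_nth[OF assms(1,2)] by (intro exI[of _ "nth xs"]) auto

text \<open>The denominator is \<open>x\<^sup>3 (x - 1)\<^sup>6 (x\<^sup>2 - 3x + 1)\<^sup>2 (x\<^sup>3 - 5x\<^sup>2 + 6x - 1)\<close>. The numerator was found
  by lattice reduction, as an integer polynomial close to the real polynomial of degree 29 and
  trace 55 with the largest alternation relative to this denominator.\<close>

definition cert_numer :: "int poly" where
  "cert_numer = [:-1, 80, -2768, 55318, -721156, 6571280, -43785772, 220267160, -856670249, 2623290596,
    -6415973286, 12676440560, -20416584299, 26997921690, -29474340320, 26674355280,
    -20065423404, 12562581618, -6545388102, 2833270780, -1015378989, 299577661, -72160492,
    14021153, -2160279, 257417, -22842, 1419, -55, 1:]"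

definition cert_denom :: "int poly" where
  "cert_denom = [:0, 0, 0, -1, 18, -139, 615, -1751, 3406, -4676, 4601, -3251, 1631, -565, 128, -17, 1:]"

text \<open>A Bezout identity with integer cofactors; at a common root it would read 0 = 1.\<close>

lemma cert_coprime:
  "[:-1, -80, -3632, -12952223, 169704108, -966341465, 3187439186, -6815596459, 9982646105,
    -10286998413, 7520187677, -3870789793, 1367500930, -314565468, 42280145, -2510618:] * cert_numer +
   [:12827785, -968632726, 31026178410, -563589229211, 6568909285418, -52787556574539,
    306894600940718, -1336334979716220, 4472921126433294, -11740489350582535,
    24544836810206587, -41373054071519493, 56768777440638925, -63875680397892253,
    59261870140391630, -45506008954325674, 28983665284035418, -15320204257687326,
    6712698600620914, -2430634185371048, 723480077140297, -175589443504220, 34340857920545,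
    -5320909998443, 637150369473, -56780147103, 3540559588, -137683629, 2510618:] * cert_denom = 1"
  by (simp add: cert_numer_def cert_denom_def one_pCons)

text \<open>The 30 points yield the 29 sign changes required by the degree. The first sign is that
  of the constant term -1. The points 0 and 1 are zeros of the denominator.\<close>

lemma cert_alternating:
  "alternating_at (of_int_poly cert_numer) (of_int_poly cert_denom) (- 1)
    [0, 3/50, 2/25, 3/25, 1/5, 6/25, 3/10, 2/5, 11/25, 13/25, 3/5, 7/10, 1, 32/25, 7/5, 3/2, 8/5,
    9/5, 2, 5/2, 13/5, 3, 16/5, 7/2, 4, 9/2, 24/5, 51/10, 131/25, 6]"
  by (simp add: cert_numer_def cert_denom_def map_poly_pCons)

interpretation cert: certificate cert_numer cert_denom
proof
  show "lead_coeff cert_numer = 1" "degree cert_denom < degree cert_numer"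
    by (simp_all add: cert_numer_def cert_denom_def)
next
  fix t :: real
  assume "poly (of_int_poly cert_numer) t = 0"
  then show "poly (of_int_poly cert_denom) t \<noteq> 0"
    \<comment> \<open>The products must stay unexpanded so that evaluation at \<open>t\<close>
      splits over their factors.\<close>
    using arg_cong[OF cert_coprime, of "\<lambda>p. poly (of_int_poly p) t"]
    by (auto simp: of_int_poly_add of_int_poly_mult simp del: mult_pCons_left mult_pCons_right)
next
  have "degree cert_numer = 29"
    by (simp add: cert_numer_def)
  then show "alternates (of_int_poly cert_numer) (of_int_poly cert_denom) (degree cert_numer)"
    by (intro alternating_at_imp_alternates[OF cert_alternating]) simp_all
qed

theorem theorem1p1:
  shows "lambda_SSS < 1.89831"
proof -
  have "degree cert_numer = 29" "coeff cert_numer 28 = - 55"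
    by (simp_all add: cert_numer_def coeff_pCons numeral_eq_Suc)
  \<comment> \<open>The trace is 55 and 55 / 29 = 1.89655..., below the claimed bound.\<close>
  then have "lambda_SSS \<le> 55 / 29"
    using lambda_SSS_le[OF cert.infinite_small_trace] by simp
  then show ?thesis by simp
qed

end
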